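(* Let $A \in \mathbb{R}^{k\times p}$ be a real matrix whose rows $A_1,\dots,A_k \in \mathbb{R}^p$ satisfy $\|A_i\|_2 = 1$ for all $i\in\{1,2,\dots,k\}$. Suppose that the orthogonality value of $A$ satisfies $ov(A) \le \epsilon$. Then $$\|AA^T\|_2 \le 1 + k\epsilon .$$
   Context: For a $k\times p$ real matrix $A$, let $\hat A$ be the matrix obtained from $A$ by normalizing each row to unit Euclidean length, and let $\hat A_i$ denote its $i$th row. The orthogonality value of $A$ is $ov(A) = \max_{i\neq j} |\langle \hat A_i, \hat A_j\rangle|$, where $\langle\cdot,\cdot\rangle$ is the standard inner product. For a matrix, $\|\cdot\|_2$ denotes the spectral norm (largest singular value); for a vector it denotes the Euclidean norm. *)

theory Defs
  imports "HOL-Analysis.Analysis"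
begin

definition normalize_rows :: "real ^ 'p ^ 'k \<Rightarrow> real ^ 'p ^ 'k" where
  "normalize_rows A = (\<chi> i. row i A /\<^sub>R norm (row i A))"

text \<open>
  Inserting \<open>0\<close> only matters for a matrix with a single row, where there are no pairs
  of distinct rows; the empty maximum is then \<open>0\<close>. Otherwise it changes nothing, all the
  other elements being nonnegative.
\<close>

definition orthogonality_value :: "real ^ 'p ^ 'k \<Rightarrow> real" where
  "orthogonality_value A =
     Max (insert 0 {\<bar>row i (normalize_rows A) \<bullet> row j (normalize_rows A)\<bar> | i j. i \<noteq> j})"

text \<open>
  Singular values as the square roots of the eigenvalues of \<open>M\<^sup>T M\<close>. If \<open>M\<close> has more columns
  than rows, this adds at most the value \<open>0\<close> to the usual list, which does not affect the largest one.
\<close>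

definition singular_values :: "real ^ 'n ^ 'm \<Rightarrow> real set" where
  "singular_values M =
     {s. s \<ge> 0 \<and> (\<exists>v. v \<noteq> 0 \<and> (transpose M ** M) *v v = s\<^sup>2 *\<^sub>R v)}"

definition spectral_norm :: "real ^ 'n ^ 'm \<Rightarrow> real" where
  "spectral_norm M = Max (singular_values M)"

text \<open>The maximum is over a finite nonempty set.\<close>

lemma inner_gram: "((transpose M ** M) *v x) \<bullet> y = (M *v x) \<bullet> (M *v y)"
  for M :: "real ^ 'n ^ 'm"
  by (metis dot_lmul_matrix inner_commute matrix_vector_mul_assoc transpose_matrix_vector)

lemma finite_singular_values: "finite (singular_values M)"
  for M :: "real ^ 'n ^ 'm"
proof -
  let ?S = "singular_values M"
  let ?B = "transpose M ** M"
  have "\<forall>s\<in>?S. \<exists>v. v \<noteq> 0 \<and> ?B *v v = s\<^sup>2 *\<^sub>R v"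
    by (auto simp: singular_values_def)
  then obtain f where f: "\<And>s. s \<in> ?S \<Longrightarrow> f s \<noteq> 0 \<and> ?B *v f s = s\<^sup>2 *\<^sub>R f s"
    by metis
  have orth: "f s \<bullet> f t = 0" if "s \<in> ?S" "t \<in> ?S" "s \<noteq> t" for s t
  proof -
    have "s\<^sup>2 * (f s \<bullet> f t) = t\<^sup>2 * (f s \<bullet> f t)"
      using inner_gram[of M "f s" "f t"] inner_gram[of M "f t" "f s"] f that
      by (simp add: inner_commute)
    moreover have "s\<^sup>2 \<noteq> t\<^sup>2"
      using that by (auto simp: singular_values_def)
    ultimately show ?thesis by simp
  qed
  have "inj_on f ?S"
    using orth f by (metis inj_onI inner_eq_zero_iff)
  moreover have "finite (f ` ?S)"
  proof (rule independent_imp_finite, rule pairwise_orthogonal_independent)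
    show "pairwise orthogonal (f ` ?S)"
      using orth by (auto simp: pairwise_def orthogonal_def)
    show "0 \<notin> f ` ?S"
      using f by force
  qed
  ultimately show ?thesis
    using finite_imageD by blast
qed

lemma singular_values_nonempty: "singular_values M \<noteq> {}"
  for M :: "real ^ 'n ^ 'm"
proof -
  let ?S = "sphere (0 :: real ^ 'n) 1"
  have "continuous_on ?S (\<lambda>x. norm (M *v x))"
    by (intro continuous_intros matrix_vector_mult_linear_continuous_on)
  moreover have "?S \<noteq> {}" by simp
  ultimately obtain v where v: "v \<in> ?S" and max: "\<And>x. x \<in> ?S \<Longrightarrow> norm (M *v x) \<le> norm (M *v v)"
    using continuous_attains_sup[of ?S "\<lambda>x. norm (M *v x)"] by auto
  define s where "s = norm (M *v v)"
  have nv: "norm v = 1" using v by simp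
  have bound: "norm (M *v x) \<le> s * norm x" for x
  proof (cases "x = 0")
    case False
    have "norm (M *v (x /\<^sub>R norm x)) \<le> s"
      unfolding s_def by (rule max) (use False in simp)
    with False show ?thesis
      by (simp add: matrix_vector_mult_scaleR field_simps)
  qed simp
  define w where "w = (transpose M ** M) *v v"
  have wv: "w \<bullet> v = s\<^sup>2"
    by (simp add: w_def inner_gram s_def power2_norm_eq_inner)
  have "w \<bullet> w = (M *v v) \<bullet> (M *v w)"
    by (simp add: w_def inner_gram)
  also have "\<dots> \<le> s * (s * norm w)"
    by (metis bound mult_left_mono norm_cauchy_schwarz norm_ge_zero order_trans s_def)
  finally have "norm w * norm w \<le> s\<^sup>2 * norm w"
    by (simp add: power2_eq_square mult.assoc flip: power2_norm_eq_inner)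
  then have nw: "norm w \<le> s\<^sup>2"
    by (metis mult_right_le_imp_le norm_ge_zero order_le_less zero_le_power2)
  have "(norm (w - s\<^sup>2 *\<^sub>R v))\<^sup>2 = (norm w)\<^sup>2 - 2 * s\<^sup>2 * (w \<bullet> v) + (s\<^sup>2)\<^sup>2 * (norm v)\<^sup>2"
    unfolding power2_norm_eq_inner
    by (simp add: inner_diff inner_commute[of v w] algebra_simps power2_eq_square)
  also have "\<dots> = (norm w)\<^sup>2 - (s\<^sup>2)\<^sup>2"
    by (simp add: wv nv power2_eq_square)
  also have "\<dots> \<le> 0"
    using power_mono[OF nw norm_ge_zero, of 2] by simp
  finally have "w = s\<^sup>2 *\<^sub>R v" by simp
  moreover have "v \<noteq> 0" "s \<ge> 0" using nv by (auto simp: s_def)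
  ultimately show ?thesis
    by (auto simp: singular_values_def w_def)
qed

end

theory Submission
  imports Defs
begin

text \<open>
  The rows of \<open>A\<close> are unit vectors, so the Gram matrix \<open>G = A A\<^sup>T\<close> has ones on the diagonal and
  entries of absolute value at most \<open>\<epsilon>\<close> off it. Hence every row of \<open>G\<close> has absolute sum at most
  \<open>1 + k \<epsilon>\<close>, so \<open>G\<close> stretches the maximum norm by at most this factor
  (\<open>infnorm_matrix_vector_mult_le\<close>). An eigenvector \<open>v\<close> of \<open>G\<^sup>T G\<close> for \<open>s\<^sup>2\<close> is thus
  stretched by \<open>s\<^sup>2\<close> exactly and by at most \<open>(1 + k \<epsilon>)\<^sup>2\<close>, since \<open>G\<close> is symmetric. This bounds
  each singular value of \<open>G\<close> by \<open>1 + k \<epsilon>\<close>, as in Gershgorin's theorem; for a matrix that need not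
  be symmetric, the argument gives Schur's test (\<open>spectral_norm_le_sqrt_row_column_sums\<close>).
\<close>

lemma infnorm_matrix_vector_mult_le:
  fixes M :: "real ^ 'n ^ 'm"
  assumes "\<And>i. (\<Sum>j\<in>UNIV. \<bar>M $ i $ j\<bar>) \<le> r"
  shows "infnorm (M *v x) \<le> r * infnorm x"
proof -
  have "\<bar>(M *v x) $ i\<bar> \<le> r * infnorm x" for i
  proof -
    have "\<bar>(M *v x) $ i\<bar> \<le> (\<Sum>j\<in>UNIV. \<bar>M $ i $ j\<bar> * \<bar>x $ j\<bar>)"
      unfolding matrix_vector_mult_def by (simp add: order_trans[OF sum_abs] abs_mult)
    also have "\<dots> \<le> (\<Sum>j\<in>UNIV. \<bar>M $ i $ j\<bar> * infnorm x)"
      by (intro sum_mono mult_left_mono component_le_infnorm_cart) simp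
    also have "\<dots> = (\<Sum>j\<in>UNIV. \<bar>M $ i $ j\<bar>) * infnorm x"
      by (simp add: sum_distrib_right)
    also have "\<dots> \<le> r * infnorm x"
      by (rule mult_right_mono[OF assms infnorm_pos_le])
    finally show ?thesis .
  qed
  then show ?thesis
    unfolding infnorm_cart by (intro cSup_least) auto
qed

text \<open>
  The column sums enter as the row sums of \<open>M\<^sup>T\<close>: the maximum norm of an eigenvector of
  \<open>M\<^sup>T M\<close> grows by at most \<open>r\<close> under \<open>M\<close> and then by at most \<open>c\<close> under \<open>M\<^sup>T\<close>, so no eigenvalue
  exceeds \<open>c r\<close>.
\<close>

lemma spectral_norm_le_sqrt_row_column_sums:
  fixes M :: "real ^ 'n ^ 'm"
  assumes rows: "\<And>i. (\<Sum>j\<in>UNIV. \<bar>M $ i $ j\<bar>) \<le> r"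
    and columns: "\<And>j. (\<Sum>i\<in>UNIV. \<bar>M $ i $ j\<bar>) \<le> c"
  shows "spectral_norm M \<le> sqrt (c * r)"
proof -
  have c: "0 \<le> c"
    by (rule order_trans[OF sum_nonneg columns]) simp
  have "s \<le> sqrt (c * r)" if s: "s \<in> singular_values M" for s
  proof -
    obtain v where v: "v \<noteq> 0" "(transpose M ** M) *v v = s\<^sup>2 *\<^sub>R v"
      using s by (auto simp: singular_values_def)
    have "s\<^sup>2 * infnorm v = infnorm (transpose M *v (M *v v))"
      using v by (simp add: matrix_vector_mul_assoc infnorm_mul)
    also have "\<dots> \<le> c * infnorm (M *v v)"
      by (rule infnorm_matrix_vector_mult_le) (simp add: transpose_def columns)
    also have "\<dots> \<le> c * (r * infnorm v)"
      by (rule mult_left_mono[OF infnorm_matrix_vector_mult_le[OF rows] c])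
    finally have "s\<^sup>2 * infnorm v \<le> (c * r) * infnorm v"
      by (simp add: mult.assoc)
    moreover have "infnorm v > 0"
      using v by (simp add: infnorm_pos_lt)
    ultimately have "s\<^sup>2 \<le> c * r"
      by simp
    then show ?thesis
      by (rule real_le_rsqrt)
  qed
  then show ?thesis
    unfolding spectral_norm_def
    by (simp add: finite_singular_values singular_values_nonempty)
qed

lemma finite_normalized_row_products:
  fixes A :: "real ^ 'p ^ 'k"
  shows "finite {\<bar>row i (normalize_rows A) \<bullet> row j (normalize_rows A)\<bar> | i j. i \<noteq> j}"
  by (rule finite_subset[where B =
        "(\<lambda>(i, j). \<bar>row i (normalize_rows A) \<bullet> row j (normalize_rows A)\<bar>) ` UNIV"]) auto

lemma orthogonality_value_nonneg: "0 \<le> orthogonality_value A"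
  unfolding orthogonality_value_def
  by (rule Max_ge) (simp_all add: finite_normalized_row_products)

lemma abs_inner_rows_le_orthogonality_value:
  fixes A :: "real ^ 'p ^ 'k"
  assumes "\<And>i. norm (row i A) = 1" and "i \<noteq> j"
  shows "\<bar>row i A \<bullet> row j A\<bar> \<le> orthogonality_value A"
proof -
  have "row i (normalize_rows A) = row i A" for i
    using assms(1)[of i] by (simp add: normalize_rows_def row_def vec_eq_iff)
  then show ?thesis
    unfolding orthogonality_value_def
    by (intro Max_ge) (use assms(2) finite_normalized_row_products[of A] in auto)
qed

theorem theorem5:
  fixes A :: "real ^ 'p ^ 'k" and \<epsilon> :: real
  assumes "\<And>i. norm (row i A) = 1"
    and "orthogonality_value A \<le> \<epsilon>"
  shows "spectral_norm (A ** transpose A) \<le> 1 + real CARD('k) * \<epsilon>"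
proof -
  define G where "G = A ** transpose A"
  have G: "G $ i $ j = row i A \<bullet> row j A" for i j
    by (simp add: G_def matrix_matrix_mult_def transpose_def row_def inner_vec_def)
  have \<epsilon>: "0 \<le> \<epsilon>"
    using orthogonality_value_nonneg assms(2) by (rule order_trans)
  have entry: "\<bar>G $ i $ j\<bar> \<le> (if i = j then 1 else 0) + \<epsilon>" for i j
    using abs_inner_rows_le_orthogonality_value[OF assms(1), of i j] assms(2) \<epsilon>
    by (auto simp: G assms(1) simp flip: power2_norm_eq_inner)
  have rows: "(\<Sum>j\<in>UNIV. \<bar>G $ i $ j\<bar>) \<le> 1 + real CARD('k) * \<epsilon>" for i
  proof -
    have "(\<Sum>j\<in>UNIV. \<bar>G $ i $ j\<bar>) \<le> (\<Sum>j\<in>UNIV. (if i = j then 1 else 0) + \<epsilon>)"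
      by (rule sum_mono) (rule entry)
    then show ?thesis
      by (simp add: sum.distrib)
  qed
  have columns: "(\<Sum>i\<in>UNIV. \<bar>G $ i $ j\<bar>) \<le> 1 + real CARD('k) * \<epsilon>" for j
    using rows[of j] by (simp add: G inner_commute)
  have "spectral_norm G \<le> sqrt ((1 + real CARD('k) * \<epsilon>) * (1 + real CARD('k) * \<epsilon>))"
    by (rule spectral_norm_le_sqrt_row_column_sums[OF rows columns])
  also have "\<dots> = 1 + real CARD('k) * \<epsilon>"
    using \<epsilon> by simp
  finally show ?thesis
    by (simp add: G_def)
qed

end
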